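(* Let $k\ge1$, $g\ge1$, $n\ge 1$, $r\ge1$ be integers, $p\in(0,1)$, $q=1-p$. The probability that there are at least $r$ success runs (of order $k$ with gap $g$) in the first $n$ trials is $$\sum_{j=r}^\infty M(k,g,n,j)=Y(k,n-(r-1)(g-1),r)+\frac1q X(k,1,n+1-(r-1)(g-1),r).$$
   Context: Consider independent trials, each $S$ (success) with probability $p$ or $F$ (failure) with probability $q=1-p$. The success runs (of order $k$ with gap $g$) are defined inductively. The first success run (if it exists) is the first run of at least $k$ consecutive successes, taken maximal. A success run terminates at its last success trial $m$ (so either $m$ is the last trial or trial $m+1$ is a failure). If the $j$-th success run terminates at trial $m$, then the $(j+1)$-th success run (if it exists) is the first run of at least $k$ consecutive successes which begins later than trial $m+g$, taken maximal among runs beginning later than trial $m+g$ (trials $m+1,\dots,m+g$ form the gap). Notation: $M(k,g,n,r)$ is the probability that a sequence of $n$ trials contains exactly $r$ success runs (of order $k$ with gap $g$). $X(k,g,n,r)$ is the probability that there is an $r$-th success run, that it terminates at trial $n-1$, and that trial $n$ is an $F$. $Y(k,n,r)=\sum_{m=1}^{n}X(k,1,m,r)$. For $r\ge 1$, $X(k,g,n,r)$ and $Y(k,n,r)$ are taken to be $0$ when $n\le 0$. *)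

theory Defs
  imports "HOL-Probability.Probability"
begin

text \<open>A finite sequence of trials is a list of Booleans, \<^const>\<open>True\<close> standing for S and
  \<^const>\<open>False\<close> for F. Trials are numbered from 1.\<close>

definition trial :: "bool list \<Rightarrow> nat \<Rightarrow> bool" where
  "trial xs i = xs ! (i - 1)"

definition long_run_after :: "nat \<Rightarrow> nat \<Rightarrow> bool list \<Rightarrow> nat \<Rightarrow> nat \<Rightarrow> bool" where
  "long_run_after k s xs a b \<longleftrightarrow>
     s < a \<and> b \<le> length xs \<and> a + k \<le> b + 1 \<and> (\<forall>i\<in>{a..b}. trial xs i)"

text \<open>Maximality is only among the runs beginning later than trial \<open>s\<close>, so trial \<open>s\<close> itself
  (the last trial of the gap) may be a success even if \<open>a = s + 1\<close>.\<close>

definition first_long_run_after :: "nat \<Rightarrow> nat \<Rightarrow> bool list \<Rightarrow> nat \<Rightarrow> nat \<Rightarrow> bool" where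
  "first_long_run_after k s xs a b \<longleftrightarrow>
     long_run_after k s xs a b \<and>
     (\<forall>a' b'. long_run_after k s xs a' b' \<longrightarrow> a \<le> a') \<and>
     (\<forall>a' b'. long_run_after k s xs a' b' \<longrightarrow> {a..b} \<subseteq> {a'..b'} \<longrightarrow> a' = a \<and> b' = b)"

text \<open>\<open>success_run k g xs j a b\<close>: the \<open>j\<close>-th success run exists, begins at trial \<open>a\<close>
  and terminates at trial \<open>b\<close>.\<close>

inductive success_run :: "nat \<Rightarrow> nat \<Rightarrow> bool list \<Rightarrow> nat \<Rightarrow> nat \<Rightarrow> nat \<Rightarrow> bool"
  for k g :: nat and xs :: "bool list" where
  first: "first_long_run_after k 0 xs a b \<Longrightarrow> success_run k g xs 1 a b"
| step: "success_run k g xs j a m \<Longrightarrow> first_long_run_after k (m + g) xs a' m' \<Longrightarrow>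
    success_run k g xs (Suc j) a' m'"

definition num_success_runs :: "nat \<Rightarrow> nat \<Rightarrow> bool list \<Rightarrow> nat" where
  "num_success_runs k g xs = card {(a, b). \<exists>j. success_run k g xs j a b}"

definition trials :: "real \<Rightarrow> nat \<Rightarrow> bool list pmf" where
  "trials p n = replicate_pmf n (bernoulli_pmf p)"

definition run_M :: "real \<Rightarrow> nat \<Rightarrow> nat \<Rightarrow> nat \<Rightarrow> nat \<Rightarrow> real" where
  "run_M p k g n r = measure_pmf.prob (trials p n) {xs. num_success_runs k g xs = r}"

text \<open>The number of trials is an integer in the next two definitions because they are used at
  arguments that may be negative. The event in \<open>run_X\<close> depends on the first \<open>n\<close> trials only.\<close>

definition run_X :: "real \<Rightarrow> nat \<Rightarrow> nat \<Rightarrow> int \<Rightarrow> nat \<Rightarrow> real" where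
  "run_X p k g n r =
     (if n \<le> 0 then 0
      else measure_pmf.prob (trials p (nat n))
        {xs. (\<exists>a. success_run k g xs r a (nat n - 1)) \<and> \<not> trial xs (nat n)})"

definition run_Y :: "real \<Rightarrow> nat \<Rightarrow> int \<Rightarrow> nat \<Rightarrow> real" where
  "run_Y p k n r = (\<Sum>m=1..n. run_X p k 1 m r)"

end

theory Submission
  imports Defs
begin

text \<open>A failure follows every success run that ends before the last trial. Hence the \<open>r\<close>-th and
  the \<open>(r + 1)\<close>-st runs depend on disjoint blocks of trials, separated by a known failure and
  \<open>g - 1\<close> free trials, so \<open>X(k,g,n,r+1)\<close> is the convolution
  \<open>\<Sum>m. X(k,g,m,r) X(k,g,n-m-g+1,1)\<close>. Since \<open>X(k,g,n,1)\<close> does not depend on \<open>g\<close>, induction on \<open>r\<close>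
  yields \<open>X(k,g,n,r) = X(k,1,n-(r-1)(g-1),r)\<close>. An \<open>r\<close>-th run within \<open>n\<close> trials ends either at
  \<open>m - 1\<close> with \<open>m \<le> n\<close>, with probability \<open>X(k,g,m,r)\<close>, or at \<open>n\<close>, with probability
  \<open>X(k,g,n+1,r) / q\<close>.\<close>

section \<open>Success runs of a fixed sequence\<close>

text \<open>Replaces the comparison with all competing runs by conditions on the trials from
  \<open>s + 1\<close> to \<open>b + 1\<close> only. Maximality becomes the failure (or the end of
  the sequence) after \<open>b\<close>, and minimality of \<open>a\<close> needs to be tested only
  on blocks of length exactly \<open>k\<close>. This locality is what lets runs be cut off and
  shifted later.\<close>

lemma first_long_run_after_iff:
  assumes k: "k \<ge> 1"
  shows "first_long_run_after k s xs a b \<longleftrightarrow>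
    long_run_after k s xs a b \<and> (b < length xs \<longrightarrow> \<not> trial xs (b + 1)) \<and>
    (\<forall>a'. s < a' \<and> a' < a \<longrightarrow> \<not> (\<forall>i\<in>{a'..<a' + k}. trial xs i))"
  (is "?L \<longleftrightarrow> ?run \<and> ?stop \<and> ?least")
proof
  assume L: ?L
  then have run: ?run
    by (simp add: first_long_run_after_def)
  have ab: "s < a" "a + k \<le> b + 1" "b \<le> length xs" "\<forall>i\<in>{a..b}. trial xs i"
    using run by (auto simp: long_run_after_def)
  have ?stop
  proof (intro impI notI)
    assume b: "b < length xs" "trial xs (b + 1)"
    have "trial xs i" if "a \<le> i" "i \<le> b + 1" for i
      using that ab(4) b(2) by (cases "i = b + 1") auto
    then have "long_run_after k s xs a (b + 1)"
      using ab b by (auto simp: long_run_after_def)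
    moreover have "{a..b} \<subseteq> {a..b + 1}"
      by auto
    ultimately have "b + 1 = b"
      using L unfolding first_long_run_after_def by blast
    then show False
      by simp
  qed
  moreover have ?least
  proof (intro allI impI notI)
    fix a' assume a': "s < a' \<and> a' < a" "\<forall>i\<in>{a'..<a' + k}. trial xs i"
    \<comment> \<open>Since \<open>a' < a\<close>, this block ends before
      \<open>a + k - 1 \<le> b\<close>, so it lies within the sequence.\<close>
    then have "long_run_after k s xs a' (a' + k - 1)"
      using ab k by (auto simp: long_run_after_def)
    then have "a \<le> a'"
      using L unfolding first_long_run_after_def by blast
    then show False
      using a' by simp
  qed
  ultimately show "?run \<and> ?stop \<and> ?least"
    using run by blast
next
  assume R: "?run \<and> ?stop \<and> ?least"
  have ab: "s < a" "a + k \<le> b + 1" "b \<le> length xs" "\<forall>i\<in>{a..b}. trial xs i"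
    using R by (auto simp: long_run_after_def)
  have least: "a \<le> a'" if "long_run_after k s xs a' b'" for a' b'
  proof (rule ccontr)
    assume "\<not> a \<le> a'"
    moreover have "s < a'" "\<forall>i\<in>{a'..<a' + k}. trial xs i"
      using that by (auto simp: long_run_after_def)
    ultimately show False
      using R by auto
  qed
  moreover have "a' = a \<and> b' = b"
    if run': "long_run_after k s xs a' b'" and sub: "{a..b} \<subseteq> {a'..b'}" for a' b'
  proof -
    have le: "a' \<le> a" "b \<le> b'"
      using sub ab k by auto
    \<comment> \<open>A longer end would make trial \<open>b + 1\<close> a success of the competing
      run, against \<open>?stop\<close>.\<close>
    have "b' = b"
    proof (rule ccontr)
      assume "b' \<noteq> b"
      then have "b < b'"
        using le by simp
      then have "trial xs (b + 1)" "b < length xs"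
        using run' le ab k by (auto simp: long_run_after_def)
      then show False
        using R by blast
    qed
    then show ?thesis
      using least[OF run'] le by simp
  qed
  ultimately show ?L
    using R unfolding first_long_run_after_def by blast
qed

lemma first_long_run_after_unique:
  assumes "first_long_run_after k s xs a b" "first_long_run_after k s xs a' b'"
  shows "a' = a \<and> b' = b"
proof -
  have "a' = a"
    using assms unfolding first_long_run_after_def by (meson order_antisym)
  \<comment> \<open>Runs with a common start are nested, so maximality of the shorter one makes them
    equal.\<close>
  moreover have "{a..b} \<subseteq> {a..b'} \<or> {a..b'} \<subseteq> {a..b}"
    by auto
  ultimately show ?thesis
    using assms unfolding first_long_run_after_def by metis
qed

section \<open>Truncating and shifting the sequence of trials\<close>

lemma trial_take: "1 \<le> i \<Longrightarrow> i \<le> m \<Longrightarrow> trial (take m xs) i \<longleftrightarrow> trial xs i"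
  by (simp add: trial_def)

lemma trial_drop: "1 \<le> i \<Longrightarrow> s \<le> length xs \<Longrightarrow> trial (drop s xs) i \<longleftrightarrow> trial xs (s + i)"
  by (simp add: trial_def)

text \<open>Truncation can interfere only when the run ends exactly at the cut \<open>m\<close>:
  there it would make the stopping condition vacuous. The assumption \<open>stop\<close> excludes
  this.\<close>

lemma first_long_run_after_take:
  assumes k: "k \<ge> 1" and m: "b \<le> m" "m \<le> length xs"
    and stop: "b = m \<Longrightarrow> m < length xs \<Longrightarrow> \<not> trial xs (m + 1)"
  shows "first_long_run_after k s (take m xs) a b \<longleftrightarrow> first_long_run_after k s xs a b"
proof (cases "s < a \<and> a + k \<le> b + 1")
  case True
  have "(\<forall>i\<in>{a..b}. trial (take m xs) i) \<longleftrightarrow> (\<forall>i\<in>{a..b}. trial xs i)"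
    using True m by (intro ball_cong) (auto simp: trial_take)
  moreover have "(\<forall>i\<in>{a'..<a' + k}. trial (take m xs) i) \<longleftrightarrow> (\<forall>i\<in>{a'..<a' + k}. trial xs i)"
    if "s < a' \<and> a' < a" for a'
    using True m that by (intro ball_cong) (auto simp: trial_take)
  moreover have "(b < m \<longrightarrow> \<not> trial (take m xs) (b + 1)) \<longleftrightarrow>
      (b < length xs \<longrightarrow> \<not> trial xs (b + 1))"
    using m stop trial_take[of "b + 1" m xs] by (cases "b = m") auto
  ultimately show ?thesis
    unfolding first_long_run_after_iff[OF k] using m
    by (auto simp: long_run_after_def min_absorb2)
next
  case False
  then show ?thesis
    by (auto simp: first_long_run_after_def long_run_after_def)
qed

text \<open>Maximality ignores runs that begin at or before \<open>s\<close>, so the search after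
  \<open>s\<close> does not see the first \<open>s\<close> trials and restarts afresh on the
  remaining ones.\<close>

lemma first_long_run_after_drop:
  assumes k: "k \<ge> 1" and s: "s \<le> length xs" and a: "0 < a"
  shows "first_long_run_after k 0 (drop s xs) a b \<longleftrightarrow> first_long_run_after k s xs (s + a) (s + b)"
proof -
  have ball: "(\<forall>i\<in>{s + c..s + d}. trial xs i) \<longleftrightarrow> (\<forall>i\<in>{c..d}. trial (drop s xs) i)"
    if "0 < c" for c d
  proof -
    have "{s + c..s + d} = (\<lambda>i. s + i) ` {c..d}"
      by simp
    then have "(\<forall>i\<in>{s + c..s + d}. trial xs i) \<longleftrightarrow> (\<forall>i\<in>{c..d}. trial xs (s + i))"
      by (metis (no_types, lifting) imageE imageI)
    then show ?thesis
      using that s by (auto simp: trial_drop)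
  qed
  have upt: "{c..<c + k} = {c..c + k - 1}" for c
    using k by auto
  have least: "(\<forall>a'. s < a' \<and> a' < s + a \<longrightarrow> \<not> (\<forall>i\<in>{a'..<a' + k}. trial xs i)) \<longleftrightarrow>
      (\<forall>a'. 0 < a' \<and> a' < a \<longrightarrow> \<not> (\<forall>i\<in>{a'..<a' + k}. trial (drop s xs) i))"
    (is "(\<forall>a'. ?P a') \<longleftrightarrow> (\<forall>a'. ?Q a')")
  proof -
    have PQ: "?P (s + c) \<longleftrightarrow> ?Q c" if "0 < c" for c
      using ball[OF that, of "c + k - 1"] k that unfolding upt by (simp add: add.assoc)
    show ?thesis
    proof
      assume P: "\<forall>a'. ?P a'"
      show "\<forall>a'. ?Q a'"
      proof
        fix c show "?Q c"
          using PQ[of c] P by (cases "0 < c") blast+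
      qed
    next
      assume Q: "\<forall>a'. ?Q a'"
      show "\<forall>a'. ?P a'"
      proof
        fix c show "?P c"
        proof (cases "s < c")
          case True
          then have "?P (s + (c - s)) \<longleftrightarrow> ?Q (c - s)"
            by (intro PQ) simp
          moreover have "s + (c - s) = c"
            using True by simp
          ultimately show ?thesis
            using Q by metis
        qed simp
      qed
    qed
  qed
  have "trial (drop s xs) (b + 1) \<longleftrightarrow> trial xs (s + b + 1)"
    using s by (simp add: trial_drop)
  then show ?thesis
    unfolding first_long_run_after_iff[OF k] long_run_after_def least ball[OF a]
    using s a by auto
qed

section \<open>Runs addressed by their index\<close>

lemma success_run_bounds:
  "success_run k g xs j a b \<Longrightarrow> 0 < a \<and> a + k \<le> b + 1 \<and> b \<le> length xs \<and> 1 \<le> j"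
  by (induction rule: success_run.induct)
    (auto simp: first_long_run_after_def long_run_after_def)

lemma success_run_1_iff: "success_run k g xs 1 a b \<longleftrightarrow> first_long_run_after k 0 xs a b"
proof
  assume "success_run k g xs 1 a b"
  then show "first_long_run_after k 0 xs a b"
    \<comment> \<open>The rule \<open>step\<close> could give index 1 only from a run of index 0,
      and indices are at least 1.\<close>
    by cases (auto dest: success_run_bounds)
qed (rule success_run.first)

lemma success_run_Suc_iff:
  assumes "1 \<le> j"
  shows "success_run k g xs (Suc j) a b \<longleftrightarrow>
    (\<exists>a' m. success_run k g xs j a' m \<and> first_long_run_after k (m + g) xs a b)"
proof
  assume "success_run k g xs (Suc j) a b"
  then show "\<exists>a' m. success_run k g xs j a' m \<and> first_long_run_after k (m + g) xs a b"
    by cases (use assms in auto)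
qed (auto intro: success_run.step)

lemma success_run_unique:
  assumes "success_run k g xs j a b" "success_run k g xs j a' b'"
  shows "a' = a \<and> b' = b"
  using assms
proof (induction arbitrary: a' b' rule: success_run.induct)
  case (first a b)
  then show ?case
    using first_long_run_after_unique success_run_1_iff by metis
next
  case (step j a m a1 m1)
  have "1 \<le> j"
    using success_run_bounds[OF step.hyps(1)] by simp
  then obtain a2 m2 where "success_run k g xs j a2 m2" "first_long_run_after k (m2 + g) xs a' b'"
    using step.prems success_run_Suc_iff by metis
  then show ?case
    using step.IH step.hyps(2) first_long_run_after_unique by metis
qed

lemma success_run_stop:
  assumes "k \<ge> 1" "success_run k g xs j a b" "b < length xs"
  shows "\<not> trial xs (b + 1)"
  using assms(2,1,3) by cases (auto simp: first_long_run_after_iff)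

lemma success_run_end_less:
  assumes "k \<ge> 1" "success_run k g xs j a b" "success_run k g xs i a' b'" "i < j"
  shows "b' < b"
  using assms(2,1,3,4)
proof (induction rule: success_run.induct)
  case (first a b)
  then show ?case
    using success_run_bounds[OF first.prems(2)] by simp
next
  case (step j a m a1 m1)
  have "m < m1"
    using step.hyps(2) step.prems(1) by (auto simp: first_long_run_after_def long_run_after_def)
  moreover have "b' \<le> m"
  proof (cases "i = j")
    case True
    then show ?thesis
      using success_run_unique[OF step.hyps(1)] step.prems by auto
  next
    case False
    then show ?thesis
      using step.IH step.prems by auto
  qed
  ultimately show ?case
    by simp
qed

text \<open>Each further run ends strictly later, so the index cannot overtake the end. This makes
  the set of indices finite.\<close>

lemma index_le_success_run_end:
  assumes "k \<ge> 1" "success_run k g xs j a b"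
  shows "j \<le> b"
  using assms(2,1)
  by (induction rule: success_run.induct)
    (auto simp: first_long_run_after_def long_run_after_def)

text \<open>Source of all independence below: where the \<open>j\<close>-th run ends is decided by a
  prefix, once the cut does not itself create that end.\<close>

lemma success_run_take_iff:
  assumes k: "k \<ge> 1" and m: "b \<le> m" "m \<le> length xs"
    and stop: "b = m \<Longrightarrow> m < length xs \<Longrightarrow> \<not> trial xs (m + 1)"
    and j: "1 \<le> j"
  shows "success_run k g (take m xs) j a b \<longleftrightarrow> success_run k g xs j a b"
  using j m(1) stop
proof (induction j arbitrary: a b rule: dec_induct)
  case base
  then show ?case
    using first_long_run_after_take[OF k base.prems(1) m(2)] by (simp add: success_run_1_iff[simplified])
next
  case (step j)
  \<comment> \<open>The next run begins after \<open>m' + g\<close>, so only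
    \<open>m' < b \<le> m\<close> matters; the cut condition of the induction hypothesis is then
    vacuous.\<close>
  have eq: "(success_run k g (take m xs) j a' m' \<and> first_long_run_after k (m' + g) (take m xs) a b) \<longleftrightarrow>
      (success_run k g xs j a' m' \<and> first_long_run_after k (m' + g) xs a b)" for a' m'
  proof (cases "m' < b")
    case True
    then show ?thesis
      using step.IH[of m' a'] first_long_run_after_take[OF k step.prems(1) m(2)] step.prems by auto
  next
    case False
    then show ?thesis
      using k by (auto simp: first_long_run_after_def long_run_after_def)
  qed
  show ?case
    unfolding success_run_Suc_iff[OF \<open>1 \<le> j\<close>] eq by simp
qed

section \<open>Counting runs by their indices\<close>

lemma success_run_index_downward:
  assumes "success_run k g xs j a b" "1 \<le> i" "i \<le> j"
  shows "\<exists>a' b'. success_run k g xs i a' b'"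
  using assms
proof (induction rule: success_run.induct)
  case (first a b)
  then have "i = 1"
    by simp
  then show ?case
    using first success_run.first by blast
next
  case (step j a m a' m')
  then show ?case
    by (cases "i = Suc j") (auto intro: success_run.step)
qed

text \<open>Indices and pairs of endpoints correspond bijectively: an index determines its run, and
  different indices have different ends.\<close>

lemma num_success_runs_eq:
  assumes k: "k \<ge> 1"
  shows "num_success_runs k g xs = card {j. \<exists>a b. success_run k g xs j a b}" (is "_ = card ?J")
proof -
  define f where "f j = (SOME ab. success_run k g xs j (fst ab) (snd ab))" for j
  have f: "success_run k g xs j (fst (f j)) (snd (f j))" if "j \<in> ?J" for j
  proof -
    from that have "\<exists>ab. success_run k g xs j (fst ab) (snd ab)"
      by auto
    then show ?thesis
      unfolding f_def by (rule someI_ex)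
  qed
  have "inj_on f ?J"
  proof (rule inj_onI)
    fix i j assume ij: "i \<in> ?J" "j \<in> ?J" "f i = f j"
    then have "\<not> i < j" "\<not> j < i"
      using f[of i] f[of j] success_run_end_less[OF k] by fastforce+
    then show "i = j"
      by simp
  qed
  moreover have "f ` ?J = {(a, b). \<exists>j. success_run k g xs j a b}"
  proof (intro equalityI subsetI)
    fix ab assume "ab \<in> f ` ?J"
    then show "ab \<in> {(a, b). \<exists>j. success_run k g xs j a b}"
      using f by (auto simp: case_prod_beta)
  next
    fix ab assume "ab \<in> {(a, b). \<exists>j. success_run k g xs j a b}"
    then obtain j where j: "success_run k g xs j (fst ab) (snd ab)"
      by (auto simp: case_prod_beta)
    then have "j \<in> ?J"
      by blast
    moreover have "f j = ab"
      using success_run_unique[OF j f[OF \<open>j \<in> ?J\<close>]] by (simp add: prod_eq_iff)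
    ultimately show "ab \<in> f ` ?J"
      by blast
  qed
  ultimately show ?thesis
    unfolding num_success_runs_def by (metis card_image)
qed

lemma success_run_indices_subset:
  assumes "k \<ge> 1"
  shows "{j. \<exists>a b. success_run k g xs j a b} \<subseteq> {1..length xs}"
  using index_le_success_run_end[OF assms] success_run_bounds by fastforce

lemma num_success_runs_le_length:
  assumes "k \<ge> 1"
  shows "num_success_runs k g xs \<le> length xs"
  using card_mono[OF _ success_run_indices_subset[OF assms]]
  by (simp add: num_success_runs_eq[OF assms])

text \<open>The indices form an initial segment of the positive integers, so there are at least
  \<open>r\<close> of them exactly when \<open>r\<close> is one of them.\<close>

lemma le_num_success_runs_iff:
  assumes k: "k \<ge> 1" and r: "r \<ge> 1"
  shows "r \<le> num_success_runs k g xs \<longleftrightarrow> (\<exists>a b. success_run k g xs r a b)"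
proof -
  let ?J = "{j. \<exists>a b. success_run k g xs j a b}"
  have fin: "finite ?J"
    by (rule finite_subset[OF success_run_indices_subset[OF k]]) simp
  show ?thesis
  proof
    assume "\<exists>a b. success_run k g xs r a b"
    then obtain a b where "success_run k g xs r a b"
      by blast
    then have "{1..r} \<subseteq> ?J"
      using success_run_index_downward[of k g xs r a b] by auto
    from card_mono[OF fin this] show "r \<le> num_success_runs k g xs"
      by (simp add: num_success_runs_eq[OF k])
  next
    assume le: "r \<le> num_success_runs k g xs"
    show "\<exists>a b. success_run k g xs r a b"
    proof (rule ccontr)
      assume none: "\<not> ?thesis"
      have "?J \<subseteq> {1..<r}"
      proof
        fix j assume "j \<in> ?J"
        then obtain a b where j: "success_run k g xs j a b"
          by blast
        then have "\<not> r \<le> j"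
          using success_run_index_downward[OF j r] none by blast
        then show "j \<in> {1..<r}"
          using success_run_bounds[OF j] by simp
      qed
      from card_mono[OF _ this] show False
        using le r by (simp add: num_success_runs_eq[OF k])
    qed
  qed
qed

section \<open>Independence of disjoint blocks of trials\<close>

lemma length_trials: "xs \<in> set_pmf (trials p n) \<Longrightarrow> length xs = n"
  by (simp add: trials_def set_replicate_pmf)

lemma prob_trials_cong:
  assumes "\<And>xs. length xs = n \<Longrightarrow> P xs \<longleftrightarrow> Q xs"
  shows "measure_pmf.prob (trials p n) {xs. P xs} = measure_pmf.prob (trials p n) {xs. Q xs}"
  by (rule measure_pmf.finite_measure_eq_AE)
    (use assms length_trials in \<open>auto simp: AE_measure_pmf_iff\<close>)

lemma trials_add:
  "trials p (m + n) = map_pmf (\<lambda>(xs, ys). xs @ ys) (pair_pmf (trials p m) (trials p n))"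
  by (simp add: trials_def replicate_pmf_distrib pair_pmf_def map_pmf_def bind_assoc_pmf
      bind_return_pmf)

text \<open>Independence of the first \<open>m\<close> trials from the remaining \<open>n\<close>,
  in the form used for every product below.\<close>

lemma prob_trials_split:
  "measure_pmf.prob (trials p (m + n)) {xs. P (take m xs) \<and> Q (drop m xs)} =
   measure_pmf.prob (trials p m) {xs. P xs} * measure_pmf.prob (trials p n) {xs. Q xs}"
proof -
  have "measure_pmf.prob (trials p (m + n)) {xs. P (take m xs) \<and> Q (drop m xs)} =
      measure_pmf.prob (pair_pmf (trials p m) (trials p n)) ({xs. P xs} \<times> {xs. Q xs})"
    unfolding trials_add measure_map_pmf
    \<comment> \<open>On the support the first component has length \<open>m\<close>, so
      \<open>take m\<close> and \<open>drop m\<close> undo the concatenation.\<close>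
    by (rule measure_pmf.finite_measure_eq_AE)
      (auto simp: AE_measure_pmf_iff dest!: length_trials)
  then show ?thesis
    by (simp add: measure_pmf_prob_product)
qed

lemma prob_trials_take:
  assumes "m \<le> n"
  shows "measure_pmf.prob (trials p n) {xs. P (take m xs)} = measure_pmf.prob (trials p m) {xs. P xs}"
  using prob_trials_split[of p m "n - m" P "\<lambda>_. True"] assms by simp

section \<open>The distribution of the end of a run\<close>

text \<open>The failure at trial \<open>n\<close> required by \<open>run_X\<close> is automatic: a
  maximal run that ends at \<open>n - 1\<close> is followed by one.\<close>

lemma run_X_eq:
  assumes k: "k \<ge> 1"
  shows "run_X p k g (int n) r =
    measure_pmf.prob (trials p n) {xs. \<exists>a. success_run k g xs r a (n - 1)}"
proof (cases "n = 0")
  case True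
  \<comment> \<open>For \<open>n = 0\<close> the natural number \<open>n - 1\<close> is 0, and no
    run of positive length ends at trial 0.\<close>
  have "\<not> success_run k g xs r a 0" for xs a
    using success_run_bounds[of k g xs r a 0] k by auto
  then show ?thesis
    using True by (simp add: run_X_def)
next
  case False
  then show ?thesis
    unfolding run_X_def using success_run_stop[OF k, of g _ r _ "n - 1"]
    by (auto intro!: prob_trials_cong)
qed

text \<open>The end at \<open>m - 1\<close> is already settled by trial \<open>m\<close>, so the
  later trials do not affect the probability.\<close>

lemma prob_success_run_end:
  assumes k: "k \<ge> 1" and r: "r \<ge> 1" and m: "1 \<le> m" "m \<le> n"
  shows "measure_pmf.prob (trials p n) {xs. \<exists>a. success_run k g xs r a (m - 1)} =
    run_X p k g (int m) r"
proof -
  have "measure_pmf.prob (trials p n) {xs. \<exists>a. success_run k g xs r a (m - 1)} =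
      measure_pmf.prob (trials p n) {xs. \<exists>a. success_run k g (take m xs) r a (m - 1)}"
    using m r k by (intro prob_trials_cong) (auto simp: success_run_take_iff)
  also have "\<dots> = run_X p k g (int m) r"
    unfolding run_X_eq[OF k]
    by (rule prob_trials_take[OF m(2), where P = "\<lambda>xs. \<exists>a. success_run k g xs r a (m - 1)"])
  finally show ?thesis .
qed

text \<open>A run that reaches the last trial \<open>n\<close> has no failure after it. Appending an
  independent failure supplies one at the cost of a factor \<open>1 - p\<close>; this is the origin
  of \<open>1 / q\<close> in the theorem.\<close>

lemma prob_success_run_last:
  assumes k: "k \<ge> 1" and r: "r \<ge> 1" and p: "0 \<le> p" "p \<le> 1"
  shows "run_X p k g (int n + 1) r =
    (1 - p) * measure_pmf.prob (trials p n) {xs. \<exists>a. success_run k g xs r a n}"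
proof -
  have "run_X p k g (int n + 1) r = measure_pmf.prob (trials p (n + 1))
      {xs. (\<exists>a. success_run k g xs r a n) \<and> \<not> trial xs (n + 1)}"
    by (simp add: run_X_def nat_add_distrib)
  also have "\<dots> = measure_pmf.prob (trials p (n + 1))
      {xs. (\<exists>a. success_run k g (take n xs) r a n) \<and> drop n xs = [False]}"
  proof (rule prob_trials_cong)
    fix xs :: "bool list" assume len: "length xs = n + 1"
    have "drop n xs = [xs ! n]"
      using len by (metis Cons_nth_drop_Suc Suc_eq_plus1 drop_all lessI order_refl)
    then have "drop n xs = [False] \<longleftrightarrow> \<not> trial xs (n + 1)"
      by (simp add: trial_def)
    then show "((\<exists>a. success_run k g xs r a n) \<and> \<not> trial xs (n + 1)) \<longleftrightarrow>
        ((\<exists>a. success_run k g (take n xs) r a n) \<and> drop n xs = [False])"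
      \<comment> \<open>The cut at \<open>n\<close> is harmless because trial \<open>n + 1\<close>
        is a failure in both events.\<close>
      using success_run_take_iff[OF k, of n n xs r g] len r by auto
  qed
  also have "\<dots> = measure_pmf.prob (trials p n) {xs. \<exists>a. success_run k g xs r a n} *
      measure_pmf.prob (trials p 1) {[False]}"
    using prob_trials_split[of p n 1 "\<lambda>xs. \<exists>a. success_run k g xs r a n" "\<lambda>xs. xs = [False]"]
    by simp
  also have "measure_pmf.prob (trials p 1) {[False]} = 1 - p"
  proof -
    have "(\<lambda>x. [x]) -` {[False]} = {False}"
      by auto
    then show ?thesis
      unfolding trials_def replicate_pmf_1 measure_map_pmf using p
      by (simp add: measure_pmf_single)
  qed
  finally show ?thesis
    by simp
qed

lemma run_X_nonpos: "N \<le> 0 \<Longrightarrow> run_X p k g N r = 0"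
  by (simp add: run_X_def)

lemma prob_two_run_ends:
  assumes k: "k \<ge> 1" and g: "g \<ge> 1" and r: "r \<ge> 1" and m: "1 \<le> m"
  shows "measure_pmf.prob (trials p n) {xs. (\<exists>a. success_run k g xs r a (m - 1)) \<and>
        (\<exists>a. first_long_run_after k (m - 1 + g) xs a (n - 1))} =
    run_X p k g (int m) r * run_X p k g (int n - int m - int g + 1) 1"
proof (cases "m - 1 + g < n")
  case True
  \<comment> \<open>\<open>s\<close> is the last trial of the gap. As \<open>g \<ge> 1\<close>, the
    first block contains trial \<open>m\<close>, which settles the \<open>r\<close>-th run; the
    second block has \<open>n - s\<close> trials.\<close>
  define s where "s = m - 1 + g"
  have s: "m \<le> s" "s < n"
    using True m g by (auto simp: s_def)
  have "measure_pmf.prob (trials p n) {xs. (\<exists>a. success_run k g xs r a (m - 1)) \<and>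
        (\<exists>a. first_long_run_after k s xs a (n - 1))} =
      measure_pmf.prob (trials p n) {xs. (\<exists>a. success_run k g (take s xs) r a (m - 1)) \<and>
        (\<exists>a. success_run k g (drop s xs) 1 a (n - s - 1))}"
  proof (rule prob_trials_cong)
    fix xs :: "bool list" assume len: "length xs = n"
    have "success_run k g (take s xs) r a (m - 1) \<longleftrightarrow> success_run k g xs r a (m - 1)" for a
      using s m len r k by (intro success_run_take_iff) auto
    moreover have "(\<exists>a. success_run k g (drop s xs) 1 a (n - s - 1)) \<longleftrightarrow>
        (\<exists>a. first_long_run_after k s xs a (n - 1))"
    proof
      assume "\<exists>a. success_run k g (drop s xs) 1 a (n - s - 1)"
      then obtain a where a: "success_run k g (drop s xs) 1 a (n - s - 1)" ..
      then have "0 < a"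
        using success_run_bounds by blast
      then have "first_long_run_after k s xs (s + a) (s + (n - s - 1))"
        using a first_long_run_after_drop[OF k, of s xs a] s len by (simp add: success_run_1_iff[simplified])
      then show "\<exists>a. first_long_run_after k s xs a (n - 1)"
        using s by auto
    next
      assume "\<exists>a. first_long_run_after k s xs a (n - 1)"
      then obtain a where a: "first_long_run_after k s xs a (n - 1)" ..
      then have "s < a"
        by (simp add: first_long_run_after_def long_run_after_def)
      then have "success_run k g (drop s xs) 1 (a - s) (n - s - 1)"
        using a first_long_run_after_drop[OF k, of s xs "a - s" "n - s - 1"] s len
        by (simp add: success_run_1_iff[simplified])
      then show "\<exists>a. success_run k g (drop s xs) 1 a (n - s - 1)" ..
    qed
    ultimately show "((\<exists>a. success_run k g xs r a (m - 1)) \<and>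
          (\<exists>a. first_long_run_after k s xs a (n - 1))) \<longleftrightarrow>
        ((\<exists>a. success_run k g (take s xs) r a (m - 1)) \<and>
          (\<exists>a. success_run k g (drop s xs) 1 a (n - s - 1)))"
      by simp
  qed
  also have "\<dots> = run_X p k g (int m) r * run_X p k g (int (n - s)) 1"
    using prob_trials_split[of p s "n - s" "\<lambda>xs. \<exists>a. success_run k g xs r a (m - 1)"
        "\<lambda>xs. \<exists>a. success_run k g xs 1 a (n - s - 1)"] s
      prob_success_run_end[OF k r m s(1)] run_X_eq[OF k, of p g "n - s" 1]
    by simp
  also have "int (n - s) = int n - int m - int g + 1"
    using s m by (simp add: s_def of_nat_diff)
  finally show ?thesis
    by (simp add: s_def)
next
  case False
  \<comment> \<open>The gap fills all \<open>n\<close> trials: the event is empty, and the second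
    factor has a nonpositive argument, where \<open>run_X\<close> is 0.\<close>
  then have "\<not> first_long_run_after k (m - 1 + g) xs a (n - 1)" for xs a
    using k by (auto simp: first_long_run_after_def long_run_after_def)
  moreover have "int n - int m - int g + 1 \<le> 0"
    using False m by linarith
  ultimately show ?thesis
    by (simp add: run_X_nonpos)
qed

section \<open>The convolution in \<open>r\<close> and the removal of the gap\<close>

lemma sum_int_atLeast1: "(\<Sum>m=1..int n. f m) = (\<Sum>m=1..n. f (int m))"
  by (rule sum.reindex_bij_witness[of _ int nat]) auto

lemma run_X_Suc:
  assumes k: "k \<ge> 1" and g: "g \<ge> 1" and r: "r \<ge> 1"
  shows "run_X p k g N (Suc r) =
    (\<Sum>m=1..N. run_X p k g m r * run_X p k g (N - m - int g + 1) 1)"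
proof (cases "N \<le> 0")
  case True
  then show ?thesis
    by (simp add: run_X_nonpos)
next
  case False
  then obtain n where N: "N = int n" and n: "n \<ge> 1"
    by (metis int_one_le_iff_zero_less linorder_not_le of_nat_1 of_nat_le_iff zero_less_imp_eq_int)
  \<comment> \<open>The events are indexed by the trial \<open>m\<close> following the
    \<open>r\<close>-th run, matching the argument of \<open>run_X\<close>; hence the witness
    \<open>Suc m\<close> below.\<close>
  let ?A = "\<lambda>m. {xs. (\<exists>a. success_run k g xs r a (m - 1)) \<and>
      (\<exists>a. first_long_run_after k (m - 1 + g) xs a (n - 1))}"
  have "(\<exists>a. success_run k g xs (Suc r) a (n - 1)) \<longleftrightarrow> (\<exists>m\<in>{1..n}. xs \<in> ?A m)" for xs
  proof
    assume "\<exists>a. success_run k g xs (Suc r) a (n - 1)"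
    then obtain a a' m where *: "success_run k g xs r a' m"
      "first_long_run_after k (m + g) xs a (n - 1)"
      using success_run_Suc_iff[OF r] by blast
    then have "m < n - 1"
      using k by (auto simp: first_long_run_after_def long_run_after_def)
    then show "\<exists>m\<in>{1..n}. xs \<in> ?A m"
      using * by (intro bexI[of _ "Suc m"]) auto
  next
    assume "\<exists>m\<in>{1..n}. xs \<in> ?A m"
    then show "\<exists>a. success_run k g xs (Suc r) a (n - 1)"
      by (blast intro: success_run.step)
  qed
  then have "run_X p k g N (Suc r) = measure_pmf.prob (trials p n) (\<Union>m\<in>{1..n}. ?A m)"
    unfolding N run_X_eq[OF k] by (auto intro!: arg_cong[where f = "measure_pmf.prob _"])
  also have "\<dots> = (\<Sum>m=1..n. measure_pmf.prob (trials p n) (?A m))"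
  proof (rule measure_pmf.finite_measure_finite_Union)
    show "disjoint_family_on ?A {1..n}"
      \<comment> \<open>The end \<open>m - 1\<close> of the \<open>r\<close>-th run is unique, and
        it determines \<open>m\<close> because \<open>m \<ge> 1\<close>.\<close>
      unfolding disjoint_family_on_def
      using success_run_unique by fastforce
  qed auto
  also have "\<dots> = (\<Sum>m=1..n. run_X p k g (int m) r * run_X p k g (int n - int m - int g + 1) 1)"
    using prob_two_run_ends[OF k g r] by (intro sum.cong) auto
  finally show ?thesis
    unfolding N sum_int_atLeast1 .
qed

lemma run_X_gap:
  assumes k: "k \<ge> 1" and g: "g \<ge> 1" and r: "r \<ge> 1"
  shows "run_X p k g N r = run_X p k 1 (N - (int r - 1) * (int g - 1)) r"
  using r
proof (induction r arbitrary: N rule: dec_induct)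
  case base
  show ?case
    by (simp add: run_X_def success_run_1_iff[simplified])
next
  case (step r)
  \<comment> \<open>\<open>D\<close> is the shift that the induction hypothesis applies to the first
    factor; the gap after the \<open>r\<close>-th run adds another \<open>g - 1\<close>, giving
    \<open>N'\<close>.\<close>
  define D where "D = (int r - 1) * (int g - 1)"
  define N' where "N' = N - (int (Suc r) - 1) * (int g - 1)"
  have N': "N' = N - D - (int g - 1)"
    by (simp add: N'_def D_def algebra_simps)
  have D: "0 \<le> D"
    using \<open>1 \<le> r\<close> g by (simp add: D_def)
  have X1: "run_X p k g M 1 = run_X p k 1 M 1" for M
    by (simp add: run_X_def success_run_1_iff[simplified])
  have "run_X p k g N (Suc r) =
      (\<Sum>m=1..N. run_X p k 1 (m - D) r * run_X p k 1 (N - m - int g + 1) 1)"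
    by (simp add: run_X_Suc[OF k g \<open>1 \<le> r\<close>] step.IH D_def X1[simplified])
  \<comment> \<open>For \<open>m \<le> D\<close> the first factor has a nonpositive argument, and
    for \<open>m > N' + D = N - g + 1\<close> the second one does.\<close>
  also have "\<dots> = (\<Sum>m=1 + D..N' + D. run_X p k 1 (m - D) r * run_X p k 1 (N - m - int g + 1) 1)"
    by (rule sum.mono_neutral_right) (use D g in \<open>auto simp: N' run_X_nonpos\<close>)
  \<comment> \<open>After substituting \<open>m + D\<close> for \<open>m\<close>, the second
    argument is \<open>N' - m\<close>: exactly the convolution for gap 1.\<close>
  also have "\<dots> = (\<Sum>m=1..N'. run_X p k 1 m r * run_X p k 1 (N' - m - int 1 + 1) 1)"
    by (rule sum.reindex_bij_witness[of _ "\<lambda>m. m + D" "\<lambda>m. m - D"]) (auto simp: N' algebra_simps)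
  also have "\<dots> = run_X p k 1 N' (Suc r)"
    by (rule run_X_Suc[OF k _ \<open>1 \<le> r\<close>, symmetric]) simp
  finally show ?case
    by (simp only: N'_def)
qed

lemma run_Y_gap:
  assumes k: "k \<ge> 1" and g: "g \<ge> 1" and r: "r \<ge> 1"
  shows "run_Y p k (int n - (int r - 1) * (int g - 1)) r = (\<Sum>m=1..n. run_X p k g (int m) r)"
proof -
  define D where "D = (int r - 1) * (int g - 1)"
  have D: "0 \<le> D"
    using r g by (simp add: D_def)
  have "(\<Sum>m=1..int n - D. run_X p k 1 m r) = (\<Sum>m=1 + D..int n. run_X p k 1 (m - D) r)"
    by (rule sum.reindex_bij_witness[of _ "\<lambda>m. m - D" "\<lambda>m. m + D"]) auto
  \<comment> \<open>The added terms \<open>m \<le> D\<close> vanish, so shifting the upper limit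
    amounts to shifting each argument.\<close>
  also have "\<dots> = (\<Sum>m=1..int n. run_X p k 1 (m - D) r)"
    by (rule sum.mono_neutral_left) (use D in \<open>auto simp: run_X_nonpos\<close>)
  also have "\<dots> = (\<Sum>m=1..int n. run_X p k g m r)"
    by (simp add: run_X_gap[OF k g r] D_def)
  finally show ?thesis
    by (simp add: run_Y_def D_def sum_int_atLeast1)
qed

section \<open>The tail of the number of success runs\<close>

lemma prob_at_least_runs:
  assumes k: "k \<ge> 1" and r: "r \<ge> 1"
  shows "measure_pmf.prob (trials p n) {xs. num_success_runs k g xs \<ge> r} =
    (\<Sum>m=1..n. run_X p k g (int m) r) +
    measure_pmf.prob (trials p n) {xs. \<exists>a. success_run k g xs r a n}"
proof -
  \<comment> \<open>The index runs up to \<open>Suc n\<close>, whose event is that of a run reaching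
    the last trial.\<close>
  let ?A = "\<lambda>m. {xs. \<exists>a. success_run k g xs r a (m - 1)}"
  have "measure_pmf.prob (trials p n) {xs. num_success_runs k g xs \<ge> r} =
      measure_pmf.prob (trials p n) {xs. xs \<in> (\<Union>m\<in>{1..Suc n}. ?A m)}"
  proof (rule prob_trials_cong)
    fix xs :: "bool list" assume "length xs = n"
    then have "b \<le> n" if "success_run k g xs r a b" for a b
      using success_run_bounds[OF that] by simp
    then show "r \<le> num_success_runs k g xs \<longleftrightarrow> xs \<in> (\<Union>m\<in>{1..Suc n}. ?A m)"
      unfolding le_num_success_runs_iff[OF k r]
      by (auto intro!: bexI[where x = "Suc _"])
  qed
  also have "\<dots> = measure_pmf.prob (trials p n) (\<Union>m\<in>{1..Suc n}. ?A m)"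
    by (simp only: Collect_mem_eq)
  also have "\<dots> = (\<Sum>m=1..Suc n. measure_pmf.prob (trials p n) (?A m))"
  proof (rule measure_pmf.finite_measure_finite_Union)
    show "disjoint_family_on ?A {1..Suc n}"
      unfolding disjoint_family_on_def
      using success_run_unique by fastforce
  qed auto
  also have "\<dots> = (\<Sum>m=1..n. measure_pmf.prob (trials p n) (?A m)) +
      measure_pmf.prob (trials p n) (?A (Suc n))"
    by simp
  also have "(\<Sum>m=1..n. measure_pmf.prob (trials p n) (?A m)) = (\<Sum>m=1..n. run_X p k g (int m) r)"
    using prob_success_run_end[OF k r] by (intro sum.cong) auto
  finally show ?thesis
    by simp
qed

text \<open>At most \<open>n\<close> runs fit into \<open>n\<close> trials, so the series is a
  finite sum of probabilities of disjoint events.\<close>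

lemma has_sum_run_M:
  assumes k: "k \<ge> 1"
  shows "((\<lambda>j. run_M p k g n j) has_sum
    measure_pmf.prob (trials p n) {xs. num_success_runs k g xs \<ge> r}) {r..}"
proof -
  have zero: "run_M p k g n j = 0" if "n < j" for j
  proof -
    have "run_M p k g n j = measure_pmf.prob (trials p n) {xs. False}"
      unfolding run_M_def
      using num_success_runs_le_length[OF k] that by (intro prob_trials_cong) (metis not_le)
    then show ?thesis
      by simp
  qed
  have "measure_pmf.prob (trials p n) {xs. num_success_runs k g xs \<ge> r} =
      measure_pmf.prob (trials p n) {xs. xs \<in> (\<Union>j\<in>{r..n}. {xs. num_success_runs k g xs = j})}"
    by (intro prob_trials_cong) (use num_success_runs_le_length[OF k] in force)
  also have "\<dots> = measure_pmf.prob (trials p n) (\<Union>j\<in>{r..n}. {xs. num_success_runs k g xs = j})"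
    by (simp only: Collect_mem_eq)
  also have "\<dots> = (\<Sum>j=r..n. run_M p k g n j)"
    unfolding run_M_def
    by (rule measure_pmf.finite_measure_finite_Union) (auto simp: disjoint_family_on_def)
  finally have "((\<lambda>j. run_M p k g n j) has_sum
      measure_pmf.prob (trials p n) {xs. num_success_runs k g xs \<ge> r}) {r..n}"
    by (intro has_sum_finiteI) auto
  moreover have "((\<lambda>j. run_M p k g n j) has_sum S) {r..n} \<longleftrightarrow>
      ((\<lambda>j. run_M p k g n j) has_sum S) {r..}" for S
    by (rule has_sum_cong_neutral) (auto simp: zero)
  ultimately show ?thesis
    by blast
qed

theorem theorem5p6:
  fixes k g n r :: nat and p q :: real
  assumes "k \<ge> 1" and "g \<ge> 1" and "n \<ge> 1" and "r \<ge> 1"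
    and "0 < p" and "p < 1" and "q = 1 - p"
  shows "((\<lambda>j. run_M p k g n j) has_sum
            measure_pmf.prob (trials p n) {xs. num_success_runs k g xs \<ge> r}) {r..} \<and>
         (\<Sum>\<^sub>\<infinity>j\<in>{r..}. run_M p k g n j) =
           run_Y p k (int n - (int r - 1) * (int g - 1)) r
           + 1 / q * run_X p k 1 (int n + 1 - (int r - 1) * (int g - 1)) r"
proof
  show sum: "((\<lambda>j. run_M p k g n j) has_sum
      measure_pmf.prob (trials p n) {xs. num_success_runs k g xs \<ge> r}) {r..}"
    by (rule has_sum_run_M[OF \<open>k \<ge> 1\<close>])
  \<comment> \<open>The shifted gap-1 term is the gap-\<open>g\<close> term at \<open>n + 1\<close>;
    dividing by \<open>q > 0\<close> removes the appended failure.\<close>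
  have "run_X p k 1 (int n + 1 - (int r - 1) * (int g - 1)) r = run_X p k g (int n + 1) r"
    by (rule run_X_gap[OF \<open>k \<ge> 1\<close> \<open>g \<ge> 1\<close> \<open>r \<ge> 1\<close>, symmetric])
  also have "\<dots> = q * measure_pmf.prob (trials p n) {xs. \<exists>a. success_run k g xs r a n}"
    using assms by (simp add: prob_success_run_last)
  finally have "1 / q * run_X p k 1 (int n + 1 - (int r - 1) * (int g - 1)) r =
      measure_pmf.prob (trials p n) {xs. \<exists>a. success_run k g xs r a n}"
    using assms by simp
  then show "(\<Sum>\<^sub>\<infinity>j\<in>{r..}. run_M p k g n j) =
      run_Y p k (int n - (int r - 1) * (int g - 1)) r
      + 1 / q * run_X p k 1 (int n + 1 - (int r - 1) * (int g - 1)) r"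
    using infsumI[OF sum] prob_at_least_runs[OF \<open>k \<ge> 1\<close> \<open>r \<ge> 1\<close>, of p n g]
      run_Y_gap[OF \<open>k \<ge> 1\<close> \<open>g \<ge> 1\<close> \<open>r \<ge> 1\<close>, of p n]
    by simp
qed

end
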